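(* Let $k\ge 4$, $n$ and $r$ be integers with $2k\le n\le 3k-2$ and $r>2(k-1)$, such that there exists at least one $r$-regular graph on $n$ vertices with chromatic number $k$. Then $d(n,r,\chi=k)=k-1$.
   Context: All graphs are finite and simple. For a graph $G$, $\chi(G)$ denotes its chromatic number. A set $S$ of vertices of $G$ together with an assignment of colors to the vertices of $S$ is a defining set of the vertex coloring of $G$ if this partial coloring extends in exactly one way to a proper coloring of all vertices of $G$ with $\chi(G)$ colors. The defining number $d(G,\chi)$ is the minimum cardinality of a defining set of $G$. For integers $n,r,k$, $d(n,r,\chi=k)$ denotes the minimum of $d(G,\chi)$ over all $r$-regular graphs $G$ on $n$ vertices with $\chi(G)=k$. *)

theory Defs
  imports Main "HOL-Library.FuncSet"
begin

definition simple_graph :: "'a set \<Rightarrow> ('a \<Rightarrow> 'a \<Rightarrow> bool) \<Rightarrow> bool" where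
  "simple_graph V adj \<longleftrightarrow>
     finite V \<and>
     (\<forall>u v. adj u v \<longrightarrow> u \<in> V \<and> v \<in> V) \<and>
     (\<forall>u v. adj u v \<longrightarrow> adj v u) \<and>
     (\<forall>v. \<not> adj v v)"

definition regular_graph :: "nat \<Rightarrow> 'a set \<Rightarrow> ('a \<Rightarrow> 'a \<Rightarrow> bool) \<Rightarrow> bool" where
  "regular_graph r V adj \<longleftrightarrow> (\<forall>v\<in>V. card {u \<in> V. adj v u} = r)"

text \<open>
  Colourings with \<open>k\<close> colours use the fixed palette \<open>{..<k}\<close> and need not be surjective. They are
  extensional functions on \<open>V\<close>, so that counting them (as in the uniqueness requirement
  below) is not affected by values outside \<open>V\<close>.
\<close>

definition proper_colorings :: "nat \<Rightarrow> 'a set \<Rightarrow> ('a \<Rightarrow> 'a \<Rightarrow> bool) \<Rightarrow> ('a \<Rightarrow> nat) set" where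
  "proper_colorings k V adj =
     {f \<in> V \<rightarrow>\<^sub>E {..<k}. \<forall>u\<in>V. \<forall>v\<in>V. adj u v \<longrightarrow> f u \<noteq> f v}"

definition chromatic_number :: "'a set \<Rightarrow> ('a \<Rightarrow> 'a \<Rightarrow> bool) \<Rightarrow> nat" where
  "chromatic_number V adj = (LEAST k. proper_colorings k V adj \<noteq> {})"

definition defining_set ::
    "'a set \<Rightarrow> ('a \<Rightarrow> 'a \<Rightarrow> bool) \<Rightarrow> 'a set \<Rightarrow> ('a \<Rightarrow> nat) \<Rightarrow> bool" where
  "defining_set V adj S c \<longleftrightarrow>
     S \<subseteq> V \<and> c \<in> S \<rightarrow>\<^sub>E {..<chromatic_number V adj} \<and>
     (\<exists>!f. f \<in> proper_colorings (chromatic_number V adj) V adj \<and> (\<forall>v\<in>S. f v = c v))"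

definition defining_number :: "'a set \<Rightarrow> ('a \<Rightarrow> 'a \<Rightarrow> bool) \<Rightarrow> nat" where
  "defining_number V adj = (LEAST m. \<exists>S c. defining_set V adj S c \<and> card S = m)"

definition regular_chromatic_graph ::
    "nat \<Rightarrow> nat \<Rightarrow> nat \<Rightarrow> 'a set \<Rightarrow> ('a \<Rightarrow> 'a \<Rightarrow> bool) \<Rightarrow> bool" where
  "regular_chromatic_graph n r k V adj \<longleftrightarrow>
     simple_graph V adj \<and> card V = n \<and> regular_graph r V adj \<and> chromatic_number V adj = k"

text \<open>
  Every finite graph is isomorphic to one whose vertices are natural numbers, so the minimum over
  all graphs is taken over those.
\<close>

definition min_defining_number :: "nat \<Rightarrow> nat \<Rightarrow> nat \<Rightarrow> nat" where
  "min_defining_number n r k =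
     (LEAST m. \<exists>(V :: nat set) adj. regular_chromatic_graph n r k V adj \<and> defining_number V adj = m)"

text \<open>
  All three minima above are taken over nonempty sets: a finite graph has a proper colouring, a
  proper colouring with the minimum number of colours is itself a defining set, and
  \<^const>\<open>min_defining_number\<close> is only of interest when a suitable graph exists.
\<close>

lemma chromatic_number_attained:
  assumes "simple_graph V adj"
  shows "proper_colorings (chromatic_number V adj) V adj \<noteq> {}"
proof -
  have "finite V" and irr: "\<not> adj v v" for v
    using assms by (auto simp: simple_graph_def)
  then obtain h where h: "bij_betw h V {0..<card V}"
    using ex_bij_betw_finite_nat by blast
  have inj: "h u = h v \<Longrightarrow> u \<in> V \<Longrightarrow> v \<in> V \<Longrightarrow> u = v" for u v
    using h by (meson bij_betw_def inj_onD)
  have rng: "v \<in> V \<Longrightarrow> h v < card V" for v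
    using h by (auto dest: bij_betwE)
  have "restrict h V \<in> proper_colorings (card V) V adj"
    using irr by (auto simp: proper_colorings_def rng dest: inj)
  then have "proper_colorings (card V) V adj \<noteq> {}" by blast
  then show ?thesis
    unfolding chromatic_number_def by (rule LeastI)
qed

lemma defining_number_attained:
  assumes "simple_graph V adj"
  shows "\<exists>S c. defining_set V adj S c \<and> card S = defining_number V adj"
proof -
  obtain f where f: "f \<in> proper_colorings (chromatic_number V adj) V adj"
    using chromatic_number_attained[OF assms] by blast
  have "g = f" if "g \<in> proper_colorings (chromatic_number V adj) V adj" "\<forall>v\<in>V. g v = f v" for g
    using that f by (auto simp: proper_colorings_def intro: PiE_ext)
  then have "\<exists>!g. g \<in> proper_colorings (chromatic_number V adj) V adj \<and> (\<forall>v\<in>V. g v = f v)"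
    using f by blast
  moreover have "f \<in> V \<rightarrow>\<^sub>E {..<chromatic_number V adj}"
    using f by (simp add: proper_colorings_def)
  ultimately have "defining_set V adj V f"
    by (simp add: defining_set_def)
  then have "\<exists>S c. defining_set V adj S c \<and> card S = card V" by blast
  then show ?thesis
    unfolding defining_number_def by (rule LeastI)
qed

end

theory Submission
  imports Defs
begin

text \<open>
  A defining set misses at most one of the \<open>k\<close> colours, since two missing colours could be swapped;
  this is the lower bound. For the upper bound let \<open>H\<close> be the complement of the graph; it has to be
  \<open>d\<close>-regular on \<open>n = 2k + s\<close> vertices, where \<open>d = n - 1 - r\<close>, and colour classes are cliques of \<open>H\<close>.
  The hypotheses give \<open>2 \<le> d \<le> s \<le> k - 2\<close>, and \<open>s d\<close> is even by the handshake lemma.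

  Put \<open>m = k - s\<close>. The colour classes are the \<open>m\<close> pairs \<open>{p\<^sub>i, y\<^sub>i}\<close> for \<open>i < m\<close> and the \<open>s\<close> triples
  \<open>{p\<^sub>i, y\<^sub>i, z\<^sub>i\<^sub>-\<^sub>m}\<close> for \<open>m \<le> i < k\<close>. The sets of all \<open>p\<^sub>i\<close> and of all \<open>y\<^sub>i\<close> are independent in \<open>H\<close>, so
  the former is a \<open>k\<close>-clique of the graph. An edge \<open>p\<^sub>j y\<^sub>i\<close> of \<open>H\<close> requires \<open>j \<le> i\<close> or \<open>i < h \<le> j\<close>.
  Colouring \<open>y\<^sub>i\<close> for \<open>i < h\<close> and \<open>p\<^sub>i\<close> for \<open>i \<ge> h\<close> then forces the other \<open>p\<^sub>j\<close> in decreasing order and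
  the other \<open>y\<^sub>i\<close> in increasing order; one suitable \<open>p\<^sub>c\<close> need not be coloured because it is adjacent in the graph to
  all coloured vertices. Finally each \<open>z\<^sub>l\<close> is forced if its own class is the only one
  with both \<open>p\<^sub>i\<close> and \<open>y\<^sub>i\<close> adjacent to it in \<open>H\<close>; edges of \<open>H\<close> among the \<open>z\<^sub>l\<close> are unrestricted and
  serve to equalise the degrees. The edges \<open>p\<^sub>j y\<^sub>i\<close> form a circulant graph of degree \<open>d - f\<close> with
  \<open>f\<close> about \<open>s d / 2 k\<close>; for \<open>m \<ge> d\<close> one takes \<open>f = 1\<close> and adds some edges among the vertices of the pairs.
\<close>

section \<open>Counting in symmetric and cyclic relations; graphs of almost constant degree\<close>

text \<open>Handshake lemma: the order splits the related pairs into increasing and decreasing ones,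
  and \<open>prod.swap\<close> exchanges the two halves.\<close>

lemma even_card_symmetric_relation:
  fixes V :: "'a::linorder set"
  assumes "finite V" "\<And>u v. E u v \<Longrightarrow> E v u" "\<And>u. \<not> E u u"
  shows "even (\<Sum>v\<in>V. card {u \<in> V. E v u})"
proof -
  let ?A = "{p \<in> V \<times> V. E (fst p) (snd p) \<and> fst p < snd p}"
  let ?B = "{p \<in> V \<times> V. E (fst p) (snd p) \<and> snd p < fst p}"
  have "(\<Sum>v\<in>V. card {u \<in> V. E v u}) = card (SIGMA v:V. {u \<in> V. E v u})"
    using assms(1) by (subst card_SigmaI) auto
  also have "(SIGMA v:V. {u \<in> V. E v u}) = ?A \<union> ?B"
    using assms(3) by (auto simp: not_less_iff_gr_or_eq)
  also have "card (?A \<union> ?B) = card ?A + card ?B"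
    by (rule card_Un_disjoint) (use assms(1) in auto)
  also have "?B = prod.swap ` ?A"
    using assms(2) by (auto simp: image_iff)
  also have "card (prod.swap ` ?A) = card ?A"
    by (rule card_image) auto
  finally show ?thesis by simp
qed

lemma cyclic_difference_eq:
  fixes k :: nat
  assumes "i < k" "j < k"
  shows "(i + k - j) mod k = (if j \<le> i then i - j else i + k - j)"
proof (cases "j \<le> i")
  case True
  then have "(i + k - j) mod k = ((i - j) + k) mod k" by simp
  then show ?thesis using True assms by (simp del: add_diff_assoc2)
qed (use assms in simp)

text \<open>One end of an edge and its cyclic difference determine the other end; so these are the
  row and column degrees of a bipartite circulant graph with connection set
  \<open>X\<close>.\<close>

lemma card_cyclic_difference:
  fixes k :: nat
  assumes "X \<subseteq> {..<k}" "j < k"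
  shows "card {i \<in> {..<k}. (i + k - j) mod k \<in> X} = card X"
    and "card {i \<in> {..<k}. (j + k - i) mod k \<in> X} = card X"
proof -
  have "bij_betw (\<lambda>i. (i + k - j) mod k) {i \<in> {..<k}. (i + k - j) mod k \<in> X} X"
    by (rule bij_betw_byWitness[where f' = "\<lambda>x. if x + j < k then x + j else x + j - k"])
       (use assms in \<open>auto simp: cyclic_difference_eq split: if_splits\<close>)
  then show "card {i \<in> {..<k}. (i + k - j) mod k \<in> X} = card X"
    by (rule bij_betw_same_card)
  have "bij_betw (\<lambda>i. (j + k - i) mod k) {i \<in> {..<k}. (j + k - i) mod k \<in> X} X"
    by (rule bij_betw_byWitness[where f' = "\<lambda>x. (j + k - x) mod k"])
       (use assms in \<open>auto simp: cyclic_difference_eq split: if_splits\<close>)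
  then show "card {i \<in> {..<k}. (j + k - i) mod k \<in> X} = card X"
    by (rule bij_betw_same_card)
qed

lemma card_residue_class:
  fixes s :: nat
  assumes "l < s"
  shows "card {t \<in> {..<N}. t mod s = l} = N div s + (if l < N mod s then 1 else 0)"
proof (induction N)
  case (Suc N)
  have "{t \<in> {..<Suc N}. t mod s = l} =
      (if N mod s = l then insert N {t \<in> {..<N}. t mod s = l} else {t \<in> {..<N}. t mod s = l})"
    by (auto simp: less_Suc_eq)
  moreover have "Suc N div s = (if Suc (N mod s) = s then Suc (N div s) else N div s)"
    by (simp add: div_Suc mod_Suc)
  moreover have "Suc N mod s = (if Suc (N mod s) = s then 0 else Suc (N mod s))"
    by (simp add: mod_Suc)
  ultimately show ?case
    using Suc.IH assms by auto
qed auto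

lemma card_split_add:
  "card {i \<in> {..<a + b :: nat}. Q i} = card {i \<in> {..<a}. Q i} + card {i \<in> {..<b}. Q (a + i)}"
proof -
  have "{i \<in> {..<a + b}. Q i} = {i \<in> {..<a}. Q i} \<union> (+) a ` {i \<in> {..<b}. Q (a + i)}"
    by (auto simp: image_iff) (metis add_less_cancel_left le_Suc_ex not_less)
  also have "card \<dots> = card {i \<in> {..<a}. Q i} + card ((+) a ` {i \<in> {..<b}. Q (a + i)})"
    by (rule card_Un_disjoint) auto
  finally show ?thesis
    by (simp add: card_image)
qed

text \<open>For odd degrees a partial matching of consecutive vertices is added to a circulant graph, for even
  degrees it is removed from one.\<close>

lemma near_regular_graph:
  fixes s g t :: nat
  assumes "t < s" "g + 2 \<le> s" "t > 0 \<Longrightarrow> g > 0" "even (s * g + t)"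
  obtains E :: "nat \<Rightarrow> nat \<Rightarrow> bool" where "\<And>u v. E u v \<Longrightarrow> E v u" "\<And>u. \<not> E u u"
    "\<And>l. l < s \<Longrightarrow> card {u \<in> {..<s}. E l u} + (if l < t then 1 else 0) = g"
proof (cases "even g")
  case True
  then obtain a where a: "g = 2 * a" by blast
  have "even t" using assms(4) a by simp
  then obtain b where b: "t = 2 * b" by blast
  \<comment> \<open>Distances up to \<open>a\<close> in both directions. The pairs
    \<open>{2 * j, 2 * j + 1}\<close> below \<open>t\<close>, which \<open>E\<close> deletes, are
    edges because \<open>t > 0\<close> forces \<open>a \<ge> 1\<close>.\<close>
  define X where "X = {1..a} \<union> {s - a..<s}"
  define E where "E u v \<longleftrightarrow> u < s \<and> v < s \<and> (v + s - u) mod s \<in> X \<and>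
    \<not> (u div 2 = v div 2 \<and> u < t \<and> v < t)" for u v
  have X_sym: "(u + s - v) mod s \<in> X" if "(v + s - u) mod s \<in> X" "u < s" "v < s" for u v
    using that assms(2) a
    unfolding X_def cyclic_difference_eq[OF that(2,3)] cyclic_difference_eq[OF that(3,2)]
    by (simp split: if_splits) arith+
  have cX: "card X = g"
    unfolding X_def using assms(2) a by (subst card_Un_disjoint) auto
  have XS: "X \<subseteq> {..<s}" unfolding X_def using assms(2) a by auto
  show ?thesis
  proof (rule that[of E])
    show "E v u" if "E u v" for u v
      using that X_sym unfolding E_def by metis
    show "\<not> E u u" for u unfolding E_def X_def using assms(2) a by auto
    fix l assume l: "l < s"
    let ?C = "{u \<in> {..<s}. (u + s - l) mod s \<in> X}"
    have C: "card ?C = g" using card_cyclic_difference(1)[OF XS l] cX by simp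
    show "card {u \<in> {..<s}. E l u} + (if l < t then 1 else 0) = g"
    proof (cases "l < t")
      case False
      then have "{u \<in> {..<s}. E l u} = ?C" using l by (auto simp: E_def)
      with False C show ?thesis by simp
    next
      case True
      define q where "q = (if even l then l + 1 else l - 1)"
      have q: "q < t" "q div 2 = l div 2" "q \<noteq> l" "\<And>u. u div 2 = l div 2 \<Longrightarrow> u = l \<or> u = q"
        using True b unfolding q_def by (auto elim!: evenE oddE)
      have "g > 0" using True assms(3) by auto
      then have "a \<ge> 1" using a by simp
      have "(q + s - l) mod s = 1 \<or> (q + s - l) mod s = s - 1"
        using l q(1) assms(1) \<open>g + 2 \<le> s\<close> unfolding q_def
        by (auto simp: cyclic_difference_eq elim!: oddE)
      then have qC: "q \<in> ?C"
        using \<open>a \<ge> 1\<close> q(1) assms(1) unfolding X_def by auto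
      have "0 \<notin> X" unfolding X_def using assms(2) a by auto
      then have "u = q" if "l div 2 = u div 2" "(u + s - l) mod s \<in> X" for u
        using q(4)[of u] that by auto
      then have "{u \<in> {..<s}. E l u} = ?C - {q}"
        using l q(1,2) True unfolding E_def by auto
      then show ?thesis using C qC True \<open>g > 0\<close> by simp
    qed
  qed
next
  case False
  then obtain a where a: "g = 2 * a + 1" by (elim oddE)
  define T where "T = s - t"
  have "even T" using assms(1,4) a unfolding T_def by (simp add: even_diff_nat)
  then obtain b where b: "T = 2 * b" by blast
  have as: "2 * a + 3 \<le> s" using assms(2) a by simp
  \<comment> \<open>Distance 1 is left out in both directions, so that the pairs
    \<open>{2 * j, 2 * j + 1}\<close> below \<open>T\<close> are new edges. The last
    \<open>t\<close> vertices stay one short; the reflection in \<open>E\<close> turns them into the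
    first \<open>t\<close>.\<close>
  define X where "X = {2..a + 1} \<union> {s - a - 1..<s - 1}"
  define D where "D u v \<longleftrightarrow> (v + s - u) mod s \<in> X \<or> u \<noteq> v \<and> u div 2 = v div 2 \<and> u < T \<and> v < T" for u v
  define E where "E u v \<longleftrightarrow> u < s \<and> v < s \<and> D (s - 1 - u) (s - 1 - v)" for u v
  have X_sym: "(u + s - v) mod s \<in> X" if "(v + s - u) mod s \<in> X" "u < s" "v < s" for u v
    using that as unfolding X_def cyclic_difference_eq[OF that(2,3)] cyclic_difference_eq[OF that(3,2)]
    by (simp split: if_splits) arith+
  have D_sym: "D v u" if "D u v" "u < s" "v < s" for u v
    using that(1) X_sym[OF _ that(2,3)] unfolding D_def by metis
  have cX: "card X = 2 * a"
    unfolding X_def using as by (subst card_Un_disjoint) auto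
  have XS: "X \<subseteq> {..<s}" unfolding X_def using as by auto
  show ?thesis
  proof (rule that[of E])
    show "E v u" if "E u v" for u v
      using that D_sym unfolding E_def by auto
    show "\<not> E u u" for u unfolding E_def D_def X_def using as by auto
    fix l assume "l < s"
    define j where "j = s - 1 - l"
    have j: "j < s" using \<open>l < s\<close> j_def by auto
    have "bij_betw (\<lambda>u. s - 1 - u) {u \<in> {..<s}. E l u} {u \<in> {..<s}. D j u}"
      by (rule bij_betw_byWitness[where f' = "\<lambda>u. s - 1 - u"])
         (use \<open>l < s\<close> in \<open>auto simp: E_def j_def\<close>)
    then have eq: "card {u \<in> {..<s}. E l u} = card {u \<in> {..<s}. D j u}"
      by (rule bij_betw_same_card)
    let ?C = "{u \<in> {..<s}. (u + s - j) mod s \<in> X}"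
    have C: "card ?C = 2 * a" using card_cyclic_difference(1)[OF XS j] cX by simp
    have lj: "l < t \<longleftrightarrow> \<not> j < T" using \<open>l < s\<close> assms(1) unfolding j_def T_def by auto
    have "card {u \<in> {..<s}. D j u} = 2 * a + (if j < T then 1 else 0)"
    proof (cases "j < T")
      case False
      then have "{u \<in> {..<s}. D j u} = ?C" by (auto simp: D_def)
      with False C show ?thesis by simp
    next
      case True
      define q where "q = (if even j then j + 1 else j - 1)"
      have q: "q < T" "q div 2 = j div 2" "q \<noteq> j" "\<And>u. u div 2 = j div 2 \<Longrightarrow> u = j \<or> u = q"
        using True b unfolding q_def by (auto elim!: evenE oddE)
      have "q < s" using q(1) T_def by simp
      have "(q + s - j) mod s = 1 \<or> (q + s - j) mod s = s - 1"
        using j \<open>q < s\<close> as unfolding q_def by (auto simp: cyclic_difference_eq elim!: oddE)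
      then have qC: "q \<notin> ?C" using as unfolding X_def by auto
      have "{u \<in> {..<s}. D j u} = insert q ?C"
        using q True \<open>q < s\<close> unfolding D_def by auto
      then show ?thesis using C qC True by simp
    qed
    then show "card {u \<in> {..<s}. E l u} + (if l < t then 1 else 0) = g"
      using eq lj a by auto
  qed
qed

section \<open>Necessary conditions: size of defining sets, parity, size of colour classes\<close>

text \<open>If two colours are missing on a partial colouring, swapping them in an extension yields a second
  extension, because a \<open>\<chi>\<close>-colouring uses every colour.\<close>

lemma card_defining_set_ge:
  assumes G: "simple_graph V adj" and D: "defining_set V adj S c"
  shows "card S \<ge> chromatic_number V adj - 1"
proof (rule ccontr)
  let ?k = "chromatic_number V adj"
  assume less: "\<not> card S \<ge> ?k - 1"
  have fS: "finite S" using G D by (auto simp: simple_graph_def defining_set_def intro: finite_subset)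
  obtain f where f: "f \<in> proper_colorings ?k V adj" "\<forall>v\<in>S. f v = c v"
    and uniq: "\<And>g. g \<in> proper_colorings ?k V adj \<Longrightarrow> \<forall>v\<in>S. g v = c v \<Longrightarrow> g = f"
    using D unfolding defining_set_def by blast
  have "card (c ` S) \<le> card S" using fS by (rule card_image_le)
  moreover have "card {..<?k} - card (c ` S) \<le> card ({..<?k} - c ` S)"
    by (rule diff_card_le_card_Diff) (use fS in simp)
  ultimately have "card ({..<?k} - c ` S) \<ge> 2" using less by simp
  then obtain T where "T \<subseteq> {..<?k} - c ` S" "card T = 2"
    by (meson obtain_subset_with_card_n)
  then obtain a b where ab: "a < ?k" "b < ?k" "a \<noteq> b" "a \<notin> c ` S" "b \<notin> c ` S"
    by (auto simp: card_2_iff)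
  have fV: "\<And>v. v \<in> V \<Longrightarrow> f v < ?k" and ext: "\<And>v. v \<notin> V \<Longrightarrow> f v = undefined"
    and proper: "\<And>u v. u \<in> V \<Longrightarrow> v \<in> V \<Longrightarrow> adj u v \<Longrightarrow> f u \<noteq> f v"
    using f(1) by (auto simp: proper_colorings_def PiE_iff extensional_def)
  define g where "g = (\<lambda>v\<in>V. if f v = a then b else if f v = b then a else f v)"
  have "g \<in> proper_colorings ?k V adj"
    using ab fV unfolding proper_colorings_def g_def by (auto dest: proper)
  moreover have "\<forall>v\<in>S. g v = c v"
    using D f(2) ab unfolding g_def defining_set_def by (auto simp: image_iff)
  ultimately have "g = f" by (rule uniq)
  have na: "f v \<noteq> a" if "v \<in> V" for v
  proof
    assume "f v = a"
    then have "g v = b" using that by (simp add: g_def)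
    with \<open>f v = a\<close> \<open>g = f\<close> \<open>a \<noteq> b\<close> show False by simp
  qed
  define g' where "g' = (\<lambda>v\<in>V. if f v = ?k - 1 then a else f v)"
  have "g' v < ?k - 1" if "v \<in> V" for v
    using fV[OF that] na[OF that] ab(1) that unfolding g'_def by auto
  moreover have "g' u \<noteq> g' v" if "u \<in> V" "v \<in> V" "adj u v" for u v
    using proper[OF that] na[OF that(1)] na[OF that(2)] that(1,2) unfolding g'_def by simp
  moreover have "g' \<in> extensional V"
    unfolding g'_def by simp
  ultimately have "g' \<in> proper_colorings (?k - 1) V adj"
    unfolding proper_colorings_def by (auto simp: PiE_iff)
  then have "?k \<le> ?k - 1"
    unfolding chromatic_number_def by (intro Least_le) auto
  then show False using ab by simp
qed

text \<open>A vertex of a colour class has its \<open>r\<close> neighbours outside the class, so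
  each of the \<open>k\<close> classes has at most \<open>n - r\<close> vertices; the parity is the
  handshake lemma.\<close>

lemma regular_chromatic_graph_bounds:
  fixes V :: "nat set"
  assumes "regular_chromatic_graph n r k V adj" "n > 0"
  shows "even (n * r)" "r < n" "n \<le> k * (n - r)"
proof -
  have fin: "finite V" and sym: "\<And>u v. adj u v \<Longrightarrow> adj v u" and irr: "\<And>v. \<not> adj v v"
    and n: "card V = n" and reg: "\<And>v. v \<in> V \<Longrightarrow> card {u \<in> V. adj v u} = r"
    and chr: "chromatic_number V adj = k" and G: "simple_graph V adj"
    using assms unfolding regular_chromatic_graph_def simple_graph_def regular_graph_def by auto
  have "(\<Sum>v\<in>V. card {u \<in> V. adj v u}) = n * r" using reg n by simp
  then show "even (n * r)"
    using even_card_symmetric_relation[of V adj] fin sym irr by simp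
  obtain v where "v \<in> V" using assms(2) n by fastforce
  have "card {u \<in> V. adj v u} \<le> card (V - {v})"
    by (rule card_mono) (use fin irr in auto)
  then show "r < n" using reg[OF \<open>v \<in> V\<close>] n \<open>v \<in> V\<close> fin assms(2) by simp
  obtain f where f: "f \<in> proper_colorings k V adj"
    using chromatic_number_attained[OF G] chr by blast
  have "V = (\<Union>i<k. {u \<in> V. f u = i})"
    using f by (auto simp: proper_colorings_def)
  then have "n = card (\<Union>i<k. {u \<in> V. f u = i})" using n by simp
  also have "\<dots> \<le> (\<Sum>i<k. card {u \<in> V. f u = i})" by (rule card_UN_le) simp
  also have "\<dots> \<le> (\<Sum>i<k. n - r)"
  proof (rule sum_mono)
    fix i assume "i \<in> {..<k}"
    show "card {u \<in> V. f u = i} \<le> n - r"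
    proof (cases "{u \<in> V. f u = i} = {}")
      case False
      then obtain v where v: "v \<in> V" "f v = i" by auto
      have "card ({u \<in> V. f u = i} \<union> {u \<in> V. adj v u}) \<le> n"
        unfolding n[symmetric] by (rule card_mono) (use fin in auto)
      moreover have "card ({u \<in> V. f u = i} \<union> {u \<in> V. adj v u}) = card {u \<in> V. f u = i} + r"
        unfolding reg[OF v(1), symmetric]
        by (rule card_Un_disjoint) (use fin f v in \<open>auto 0 3 simp: proper_colorings_def\<close>)
      ultimately show ?thesis by simp
    qed (simp only: card.empty)
  qed
  finally show "n \<le> k * (n - r)" by simp
qed

section \<open>Forced colourings of the three-layer graph\<close>

lemma chromatic_number_eqI:
  assumes "proper_colorings k V adj \<noteq> {}"
    and K: "K \<subseteq> V" "card K = k" "\<And>u v. u \<in> K \<Longrightarrow> v \<in> K \<Longrightarrow> u \<noteq> v \<Longrightarrow> adj u v"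
  shows "chromatic_number V adj = k"
  unfolding chromatic_number_def
proof (rule Least_equality)
  fix j assume "proper_colorings j V adj \<noteq> {}"
  then obtain f where f: "f \<in> proper_colorings j V adj" by blast
  have "inj_on f K" using f K unfolding proper_colorings_def inj_on_def by blast
  moreover have "f ` K \<subseteq> {..<j}" using f K(1) unfolding proper_colorings_def by (auto simp: PiE_iff)
  ultimately have "card K \<le> card {..<j}" by (metis card_inj_on_le finite_lessThan)
  then show "k \<le> j" using K(2) by simp
qed (rule assms(1))

text \<open>The vertices are \<open>p\<^sub>i = i\<close> and \<open>y\<^sub>i = k + i\<close> for \<open>i < k\<close>, and \<open>z\<^sub>l = 2 * k + l\<close> for \<open>l < s\<close>. The relations
  \<open>PY\<close>, \<open>ZP\<close>, \<open>ZY\<close> and \<open>ZZ\<close> describe the complement of the graph. The defining set consists of \<open>y\<^sub>i\<close>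
  for \<open>i < h\<close> and of \<open>p\<^sub>i\<close> for \<open>h \<le> i \<noteq> c\<close>.\<close>

lemma defining_set_three_layers:
  fixes k s m h c d :: nat and PY ZP ZY ZZ :: "nat \<Rightarrow> nat \<Rightarrow> bool"
  assumes ks: "k = m + s" and c: "h \<le> c" "c < k"
    and PY_refl: "\<And>i. i < k \<Longrightarrow> PY i i"
    and PY_order: "\<And>j i. PY j i \<Longrightarrow> j < k \<Longrightarrow> i < k \<Longrightarrow> j \<le> i \<or> i < h \<and> h \<le> j"
    and PY_c: "\<And>i. PY c i \<Longrightarrow> i < k \<Longrightarrow> h \<le> i"
    and Z_own: "\<And>l. l < s \<Longrightarrow> ZP l (m + l) \<and> ZY l (m + l)"
    and Z_unique: "\<And>l i. l < s \<Longrightarrow> i < k \<Longrightarrow> ZP l i \<Longrightarrow> ZY l i \<Longrightarrow> i = m + l"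
    and ZZ: "\<And>u v. ZZ u v \<Longrightarrow> ZZ v u" "\<And>u. \<not> ZZ u u"
    and deg_P: "\<And>i. i < k \<Longrightarrow> card {j \<in> {..<k}. PY i j} + card {l \<in> {..<s}. ZP l i} = d"
    and deg_Y: "\<And>i. i < k \<Longrightarrow> card {j \<in> {..<k}. PY j i} + card {l \<in> {..<s}. ZY l i} = d"
    and deg_Z: "\<And>l. l < s \<Longrightarrow>
       card {i \<in> {..<k}. ZP l i} + card {i \<in> {..<k}. ZY l i} + card {u \<in> {..<s}. ZZ l u} = d"
  obtains V :: "nat set" and adj S col where
    "regular_chromatic_graph (2 * k + s) (2 * k + s - 1 - d) k V adj"
    "defining_set V adj S col" "card S = k - 1"
proof -
  define half where "half x y \<longleftrightarrow>
      x < k \<and> k \<le> y \<and> y < 2 * k \<and> PY x (y - k) \<or>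
      x < k \<and> 2 * k \<le> y \<and> ZP (y - 2 * k) x \<or>
      k \<le> x \<and> x < 2 * k \<and> 2 * k \<le> y \<and> ZY (y - 2 * k) (x - k) \<or>
      2 * k \<le> x \<and> 2 * k \<le> y \<and> ZZ (x - 2 * k) (y - 2 * k)" for x y
  define H where "H x y \<longleftrightarrow> half x y \<or> half y x" for x y
  define V where "V = {..<2 * k + s}"
  define adj where "adj x y \<longleftrightarrow> x \<in> V \<and> y \<in> V \<and> x \<noteq> y \<and> \<not> H x y" for x y
  have H_PY [simp]: "\<not> H i j" "H i (k + j) \<longleftrightarrow> PY i j" "H (k + i) j \<longleftrightarrow> PY j i" "\<not> H (k + i) (k + j)"
    if "i < k" "j < k" for i j using that by (auto simp: H_def half_def)
  have H_Z [simp]: "H i (2 * k + l) \<longleftrightarrow> ZP l i" "H (k + i) (2 * k + l) \<longleftrightarrow> ZY l i"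
    "H (2 * k + l) i \<longleftrightarrow> ZP l i" "H (2 * k + l) (k + i) \<longleftrightarrow> ZY l i"
    if "i < k" for i l using that by (auto simp: H_def half_def)
  have H_ZZ [simp]: "H (2 * k + l) (2 * k + u) \<longleftrightarrow> ZZ l u" for l u
    using ZZ by (auto simp: H_def half_def)
  have H_irr: "\<not> H x x" for x
    using ZZ(2) by (auto simp: H_def half_def)
  have V_cases: "(\<exists>i<k. v = i) \<or> (\<exists>i<k. v = k + i) \<or> (\<exists>l<s. v = 2 * k + l)" if "v \<in> V" for v
    using that unfolding V_def by (simp, presburger)
  have count: "card {x \<in> V. Q x} = card {i \<in> {..<k}. Q i} + card {i \<in> {..<k}. Q (k + i)}
      + card {l \<in> {..<s}. Q (2 * k + l)}" for Q
    unfolding V_def card_split_add mult_2 by simp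
  have deg_H: "card {x \<in> V. H v x} = d" if "v \<in> V" for v
    using V_cases[OF that]
  proof (elim disjE exE conjE)
    fix i assume i: "i < k" "v = i"
    have "{j \<in> {..<k}. H i j} = {}" "{j \<in> {..<k}. H i (k + j)} = {j \<in> {..<k}. PY i j}"
      "{l \<in> {..<s}. H i (2 * k + l)} = {l \<in> {..<s}. ZP l i}"
      using i by auto
    then show ?thesis unfolding count i(2) using deg_P[OF i(1)] by (simp only: card.empty add_0)
  next
    fix i assume i: "i < k" "v = k + i"
    have "{j \<in> {..<k}. H (k + i) j} = {j \<in> {..<k}. PY j i}" "{j \<in> {..<k}. H (k + i) (k + j)} = {}"
      "{l \<in> {..<s}. H (k + i) (2 * k + l)} = {l \<in> {..<s}. ZY l i}"
      using i by auto
    then show ?thesis unfolding count i(2) using deg_Y[OF i(1)] by (simp only: card.empty add_0_right)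
  next
    fix l assume l: "l < s" "v = 2 * k + l"
    have "{j \<in> {..<k}. H (2 * k + l) j} = {j \<in> {..<k}. ZP l j}"
      "{j \<in> {..<k}. H (2 * k + l) (k + j)} = {j \<in> {..<k}. ZY l j}"
      "{u \<in> {..<s}. H (2 * k + l) (2 * k + u)} = {u \<in> {..<s}. ZZ l u}"
      by auto
    then show ?thesis unfolding count l(2) using deg_Z[OF l(1)] by (simp only:)
  qed
  have G: "simple_graph V adj"
    unfolding simple_graph_def adj_def V_def by (auto simp: H_def)
  have "card {x \<in> V. adj v x} = 2 * k + s - 1 - d" if "v \<in> V" for v
  proof -
    have "{x \<in> V. adj v x} = (V - {v}) - {x \<in> V. H v x}"
      using that by (auto simp: adj_def)
    moreover have "card ((V - {v}) - {x \<in> V. H v x}) = card (V - {v}) - card {x \<in> V. H v x}"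
      by (rule card_Diff_subset) (use H_irr in \<open>auto simp: V_def\<close>)
    ultimately show ?thesis using deg_H[OF that] that by (simp add: V_def)
  qed
  then have reg: "regular_graph (2 * k + s - 1 - d) V adj"
    unfolding regular_graph_def by blast
  define f where "f = (\<lambda>v\<in>V. if v < k then v else if v < 2 * k then v - k else m + (v - 2 * k))"
  have f_simps: "i < k \<Longrightarrow> f i = i" "i < k \<Longrightarrow> f (k + i) = i" "l < s \<Longrightarrow> f (2 * k + l) = m + l" for i l
    unfolding f_def V_def by auto
  have ml: "l < s \<Longrightarrow> m + l < k" for l using ks by simp
  have f_class: "H u v" if "u \<in> V" "v \<in> V" "u \<noteq> v" "f u = f v" for u v
    using V_cases[OF that(1)] V_cases[OF that(2)] that(3,4) PY_refl Z_own ml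
    by (auto simp: f_simps)
  have f_col: "f \<in> proper_colorings k V adj"
  proof -
    have "f v < k" if "v \<in> V" for v using V_cases[OF that] ml by (auto simp: f_simps)
    moreover have "f \<in> extensional V" by (simp add: f_def)
    ultimately show ?thesis
      using f_class unfolding proper_colorings_def by (auto simp: PiE_iff adj_def)
  qed
  have chr: "chromatic_number V adj = k"
  proof (rule chromatic_number_eqI[of k V adj "{..<k}"])
    show "adj u v" if "u \<in> {..<k}" "v \<in> {..<k}" "u \<noteq> v" for u v
      using that by (auto simp: adj_def V_def)
  qed (use f_col in \<open>auto simp: V_def\<close>)
  define S where "S = (+) k ` {..<h} \<union> ({h..<k} - {c})"
  have SV: "S \<subseteq> V" using c by (auto simp: S_def V_def)
  have "card S = card ((+) k ` {..<h}) + card ({h..<k} - {c})"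
    unfolding S_def by (rule card_Un_disjoint) auto
  then have "card S = k - 1" using c by (simp add: card_image)
  have "g = f" if g: "g \<in> proper_colorings k V adj" and gS: "\<forall>v\<in>S. g v = restrict f S v" for g
  proof -
    have g_lt: "g v < k" if "v \<in> V" for v
      using g that by (auto simp: proper_colorings_def PiE_iff)
    have g_H: "H u v" if "u \<in> V" "v \<in> V" "u \<noteq> v" "g u = g v" for u v
      using g that unfolding proper_colorings_def adj_def by blast
    have [simp]: "i < k \<Longrightarrow> i \<in> V" "i < k \<Longrightarrow> k + i \<in> V" "l < s \<Longrightarrow> 2 * k + l \<in> V" for i l
      by (auto simp: V_def)
    have gP: "i = j" if "g i = g j" "i < k" "j < k" for i j
      using g_H[of i j] that by auto
    have gY: "i = j" if "g (k + i) = g (k + j)" "i < k" "j < k" for i j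
      using g_H[of "k + i" "k + j"] that by auto
    have gPY: "PY i j" if "g i = g (k + j)" "i < k" "j < k" for i j
      using g_H[of i "k + j"] that by auto
    have pin_Y: "g (k + i) = i" if "i < h" for i
      using gS that c by (auto simp: S_def f_simps)
    have pin_P: "g i = i" if "h \<le> i" "i < k" "i \<noteq> c" for i
      using gS that by (auto simp: S_def f_simps)
    \<comment> \<open>The other colours from \<open>h\<close> on sit on vertices of the clique
      containing \<open>p\<^sub>c\<close>; the colours below \<open>h\<close> sit on
      \<open>y\<close> vertices that are not joined to \<open>p\<^sub>c\<close> in \<open>H\<close>,
      by \<open>PY_c\<close>.\<close>
    have "g c = c"
    proof (rule ccontr)
      assume ne: "g c \<noteq> c"
      have lt: "g c < k" using g_lt c by simp
      show False
      proof (cases "g c < h")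
        case True
        then have "PY c (g c)" using gPY[of c "g c"] pin_Y lt c by simp
        then show False using PY_c lt True by force
      next
        case False
        then have "g (g c) = g c" using pin_P ne lt by simp
        then show False using gP lt c(2) ne by blast
      qed
    qed
    then have high_P: "g i = i" if "h \<le> i" "i < k" for i
      using pin_P that by blast
    \<comment> \<open>Index \<open>i\<close> stands for column \<open>h - 1 - i\<close>, so the
      induction runs downwards: \<open>PY_order\<close> leaves \<open>p\<^sub>j\<close> only colours
      from \<open>j\<close> to \<open>h - 1\<close>, and those above \<open>j\<close> are
      taken.\<close>
    have low_P: "i < h \<Longrightarrow> g (h - 1 - i) = h - 1 - i" for i
    proof (induction i rule: less_induct)
      case (less i)
      define j where "j = h - 1 - i"
      have j: "j < h" "j < k" using less.prems c j_def by auto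
      have lt: "g j < k" using g_lt j by simp
      have "g j < h"
      proof (rule ccontr)
        assume "\<not> g j < h"
        then have "g (g j) = g j" using high_P lt by simp
        then show False using gP lt j \<open>\<not> g j < h\<close> by metis
      qed
      then have "PY j (g j)" using gPY[of j "g j"] pin_Y lt j by simp
      then have "j \<le> g j" using PY_order lt j by fastforce
      moreover have "\<not> j < g j"
      proof
        assume "j < g j"
        define i' where "i' = h - 1 - g j"
        have "i' < i" "i' < h" "h - 1 - i' = g j"
          using \<open>j < g j\<close> \<open>g j < h\<close> less.prems unfolding i'_def j_def by auto
        then have "g (g j) = g j" using less.IH[of i'] by simp
        then show False using gP lt j \<open>j < g j\<close> by (metis less_irrefl)
      qed
      ultimately show ?case unfolding j_def[symmetric] by simp
    qed
    have all_P: "g i = i" if "i < k" for i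
    proof (cases "i < h")
      case True
      then show ?thesis using low_P[of "h - 1 - i"] by simp
    qed (use high_P that in simp)
    \<comment> \<open>For \<open>i \<ge> h\<close>, \<open>PY_order\<close> leaves only colours up
      to \<open>i\<close>, and the smaller ones are held by earlier \<open>y\<close>
      vertices.\<close>
    have all_Y: "i < k \<Longrightarrow> g (k + i) = i" for i
    proof (induction i rule: less_induct)
      case (less i)
      show ?case
      proof (cases "i < h")
        case False
        have lt: "g (k + i) < k" using g_lt less.prems by simp
        have "PY (g (k + i)) i" using gPY[of "g (k + i)" i] all_P lt less.prems by simp
        then have le: "g (k + i) \<le> i" using PY_order lt less.prems False by blast
        show ?thesis
        proof (rule ccontr)
          assume "g (k + i) \<noteq> i"
          then have "g (k + g (k + i)) = g (k + i)" using less.IH le lt by simp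
          then show False using gY lt less.prems \<open>g (k + i) \<noteq> i\<close> by blast
        qed
      qed (use pin_Y in simp)
    qed
    have all_Z: "g (2 * k + l) = m + l" if l: "l < s" for l
    proof -
      define i where "i = g (2 * k + l)"
      have i: "i < k" using g_lt l i_def by simp
      have "ZP l i" using g_H[of "2 * k + l" i] all_P[OF i] l i i_def[symmetric] by simp
      moreover have "ZY l i" using g_H[of "2 * k + l" "k + i"] all_Y[OF i] l i i_def[symmetric] by simp
      ultimately show ?thesis using Z_unique[OF l i] i_def[symmetric] by simp
    qed
    have "g v = f v" if "v \<in> V" for v
      using V_cases[OF that] all_P all_Y all_Z by (auto simp: f_simps)
    moreover have "g v = f v" if "v \<notin> V" for v
      using that g f_col by (auto simp: proper_colorings_def PiE_def extensional_def)
    ultimately show ?thesis by blast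
  qed
  moreover have "restrict f S \<in> S \<rightarrow>\<^sub>E {..<k}"
    using f_col SV unfolding proper_colorings_def by auto
  ultimately have "defining_set V adj S (restrict f S)"
    unfolding defining_set_def chr using SV f_col by (intro conjI ex1I[of _ f]) auto
  moreover have "regular_chromatic_graph (2 * k + s) (2 * k + s - 1 - d) k V adj"
    unfolding regular_chromatic_graph_def using G reg chr by (simp add: V_def)
  ultimately show thesis using that \<open>card S = k - 1\<close> by blast
qed

text \<open>Every vertex \<open>z\<^sub>l\<close> is attached cyclically to the columns \<open>m, \<dots>, k - 1\<close>. The missing degrees in the
  columns below \<open>m\<close> are listed as slots \<open>t < N\<close>, where slot \<open>t\<close> belongs to the \<open>p\<close>-vertex or the
  \<open>y\<close>-vertex of column \<open>q t\<close> according to \<open>side t\<close>, and are filled by the vertices \<open>z\<close> in rotation.\<close>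

lemma defining_set_from_slots:
  fixes k s m h c d f N :: nat and PY :: "nat \<Rightarrow> nat \<Rightarrow> bool" and q :: "nat \<Rightarrow> nat" and side :: "nat \<Rightarrow> bool"
  assumes ks: "k = m + s" and c: "h \<le> c" "c < k"
    and PY_refl: "\<And>i. i < k \<Longrightarrow> PY i i"
    and PY_order: "\<And>j i. PY j i \<Longrightarrow> j < k \<Longrightarrow> i < k \<Longrightarrow> j \<le> i \<or> i < h \<and> h \<le> j"
    and PY_c: "\<And>i. PY c i \<Longrightarrow> i < k \<Longrightarrow> h \<le> i"
    and f: "1 \<le> f" "2 * f \<le> d" and ds: "d \<le> s" "even (s * d)"
    and N: "N \<le> s * (d - 2 * f)" "even N"
    and q: "\<And>t. t < N \<Longrightarrow> q t < m"
    and q_inj: "\<And>t t'. t < N \<Longrightarrow> t' < N \<Longrightarrow> q t = q t' \<Longrightarrow> t mod s = t' mod s \<Longrightarrow> t = t'"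
    and low_P: "\<And>i. i < m \<Longrightarrow> card {j \<in> {..<k}. PY i j} + card {t \<in> {..<N}. q t = i \<and> side t} = d"
    and low_Y: "\<And>i. i < m \<Longrightarrow> card {j \<in> {..<k}. PY j i} + card {t \<in> {..<N}. q t = i \<and> \<not> side t} = d"
    and high_P: "\<And>i. m \<le> i \<Longrightarrow> i < k \<Longrightarrow> card {j \<in> {..<k}. PY i j} + f = d"
    and high_Y: "\<And>i. m \<le> i \<Longrightarrow> i < k \<Longrightarrow> card {j \<in> {..<k}. PY j i} + f = d"
  obtains V :: "nat set" and adj S col where
    "regular_chromatic_graph (2 * k + s) (2 * k + s - 1 - d) k V adj"
    "defining_set V adj S col" "card S = k - 1"
proof -
  \<comment> \<open>Each \<open>z\<^sub>l\<close> gets \<open>2 * f\<close> edges to the columns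
    from \<open>m\<close> on and \<open>N div s\<close> slots, one more if \<open>l < T\<close>. The
    rest of its degree, \<open>g\<close> or \<open>g - 1\<close>, has to come from
    \<open>ZZ\<close>.\<close>
  define g where "g = d - 2 * f - N div s"
  define T where "T = N mod s"
  have s: "s > 0" using f ds by simp
  have Ns: "N = s * (N div s) + T" unfolding T_def by simp
  have Nle: "N div s \<le> d - 2 * f"
    using N(1) s by (metis div_le_mono nonzero_mult_div_cancel_left not_gr_zero)
  have g_eq: "g + N div s + 2 * f = d" using Nle f(2) unfolding g_def by simp
  have "T < s" unfolding T_def using s by simp
  moreover have "g + 2 \<le> s" using f ds(1) unfolding g_def by simp
  moreover have "g > 0" if "T > 0"
  proof (rule ccontr)
    assume "\<not> g > 0"
    then have "d - 2 * f = N div s" using Nle unfolding g_def by simp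
    then show False using N(1) Ns that by simp
  qed
  moreover have "even (s * g + T)"
  proof -
    have "s * d = s * g + s * (N div s) + 2 * (s * f)"
      unfolding g_eq[symmetric] by (simp add: algebra_simps)
    then have "s * d + T + T = s * g + T + N + 2 * (s * f)" using Ns by simp
    then have "even (s * g + T + N + 2 * (s * f))" using ds(2)
      by (metis dvd_add_triv_right_iff even_add)
    then show ?thesis using N(2) by simp
  qed
  ultimately obtain ZZ where ZZ: "\<And>u v. ZZ u v \<Longrightarrow> ZZ v u" "\<And>u. \<not> ZZ u u"
    "\<And>l. l < s \<Longrightarrow> card {u \<in> {..<s}. ZZ l u} + (if l < T then 1 else 0) = g"
    using near_regular_graph[of T s g] by blast
  \<comment> \<open>Two sets of size \<open>f\<close> that share only the difference 0, which
    belongs to the column of \<open>z\<^sub>l\<close> itself.\<close>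
  define A B where "A = {..<f}" and "B = insert 0 {f..<2 * f - 1}"
  have AB: "A \<subseteq> {..<s}" "B \<subseteq> {..<s}" "card A = f" "card B = f" "A \<inter> B = {0}"
    using f ds(1) unfolding A_def B_def by auto
  define slot where "slot b l i \<longleftrightarrow> (\<exists>t<N. t mod s = l \<and> q t = i \<and> side t = b)" for b l i
  define ZP where "ZP l i \<longleftrightarrow> (if i < m then slot True l i else (i - m + s - l) mod s \<in> A)" for l i
  define ZY where "ZY l i \<longleftrightarrow> (if i < m then slot False l i else (i - m + s - l) mod s \<in> B)" for l i
  \<comment> \<open>By \<open>q_inj\<close> the slots of one column go to distinct \<open>z\<close>
    vertices, so counting slots counts edges.\<close>
  have slot_col: "card {l \<in> {..<s}. slot b l i} = card {t \<in> {..<N}. q t = i \<and> side t = b}" for b i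
  proof -
    have "{l \<in> {..<s}. slot b l i} = (\<lambda>t. t mod s) ` {t \<in> {..<N}. q t = i \<and> side t = b}"
      using s unfolding slot_def by auto
    moreover have "inj_on (\<lambda>t. t mod s) {t \<in> {..<N}. q t = i \<and> side t = b}"
      using q_inj by (auto intro!: inj_onI)
    ultimately show ?thesis by (simp add: card_image)
  qed
  have slot_row: "card {i \<in> {..<m}. slot b l i} = card {t \<in> {..<N}. t mod s = l \<and> side t = b}" for b l
  proof -
    have "{i \<in> {..<m}. slot b l i} = q ` {t \<in> {..<N}. t mod s = l \<and> side t = b}"
      using q unfolding slot_def by auto
    moreover have "inj_on q {t \<in> {..<N}. t mod s = l \<and> side t = b}"
      using q_inj by (auto intro!: inj_onI)
    ultimately show ?thesis by (simp add: card_image)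
  qed
  have slot_rows: "card {i \<in> {..<m}. slot True l i} + card {i \<in> {..<m}. slot False l i} =
      N div s + (if l < T then 1 else 0)" if "l < s" for l
  proof -
    have "{t \<in> {..<N}. t mod s = l} = {t \<in> {..<N}. t mod s = l \<and> side t = True} \<union>
        {t \<in> {..<N}. t mod s = l \<and> side t = False}" by auto
    moreover have "card ({t \<in> {..<N}. t mod s = l \<and> side t = True} \<union>
        {t \<in> {..<N}. t mod s = l \<and> side t = False}) =
        card {t \<in> {..<N}. t mod s = l \<and> side t = True} + card {t \<in> {..<N}. t mod s = l \<and> side t = False}"
      by (rule card_Un_disjoint) auto
    ultimately show ?thesis
      unfolding slot_row using card_residue_class[OF that, of N] by (simp only: T_def)
  qed
  show thesis
  proof (rule defining_set_three_layers[where ZP = ZP and ZY = ZY, OF ks c PY_refl PY_order PY_c _ _ ZZ(1,2) _ _ _ that])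
    show "ZP l (m + l) \<and> ZY l (m + l)" if "l < s" for l
      using AB(5) that unfolding ZP_def ZY_def by auto
    show "i = m + l" if l: "l < s" and i: "i < k" and z: "ZP l i" "ZY l i" for l i
    proof (cases "i < m")
      case True
      then have "slot True l i" "slot False l i" using z unfolding ZP_def ZY_def by auto
      then obtain t t' where t: "t < N" "t' < N" "t mod s = t' mod s" "q t = q t'" "side t" "\<not> side t'"
        unfolding slot_def by auto
      then show ?thesis using q_inj[of t t'] by auto
    next
      case False
      then have "(i - m + s - l) mod s \<in> A \<inter> B" using z unfolding ZP_def ZY_def by auto
      then have "(i - m + s - l) mod s = 0" using AB(5) by blast
      moreover have "i - m < s" using False i ks by simp
      ultimately have "i - m = l" using l cyclic_difference_eq[of "i - m" s l] by (auto split: if_splits)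
      then show ?thesis using False by simp
    qed
    show "card {j \<in> {..<k}. PY i j} + card {l \<in> {..<s}. ZP l i} = d" if "i < k" for i
    proof (cases "i < m")
      case True
      then show ?thesis using low_P[OF True] slot_col[of True i] unfolding ZP_def by simp
    next
      case False
      then obtain x where "i = m + x" using le_Suc_ex not_less by blast
      then show ?thesis
        using card_cyclic_difference(2)[OF AB(1), of x] AB(3) high_P[of i] that ks unfolding ZP_def by simp
    qed
    show "card {j \<in> {..<k}. PY j i} + card {l \<in> {..<s}. ZY l i} = d" if "i < k" for i
    proof (cases "i < m")
      case True
      then show ?thesis using low_Y[OF True] slot_col[of False i] unfolding ZY_def by simp
    next
      case False
      then obtain x where "i = m + x" using le_Suc_ex not_less by blast
      then show ?thesis
        using card_cyclic_difference(2)[OF AB(2), of x] AB(4) high_Y[of i] that ks unfolding ZY_def by simp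
    qed
    show "card {i \<in> {..<k}. ZP l i} + card {i \<in> {..<k}. ZY l i} + card {u \<in> {..<s}. ZZ l u} = d"
      if l: "l < s" for l
    proof -
      have "card {i \<in> {..<k}. ZP l i} = card {i \<in> {..<m}. slot True l i} + f"
      proof -
        have "{i \<in> {..<m}. ZP l i} = {i \<in> {..<m}. slot True l i}"
          "{i \<in> {..<s}. ZP l (m + i)} = {i \<in> {..<s}. (i + s - l) mod s \<in> A}"
          unfolding ZP_def by auto
        then show ?thesis
          unfolding ks card_split_add using card_cyclic_difference(1)[OF AB(1) l] AB(3) by simp
      qed
      moreover have "card {i \<in> {..<k}. ZY l i} = card {i \<in> {..<m}. slot False l i} + f"
      proof -
        have "{i \<in> {..<m}. ZY l i} = {i \<in> {..<m}. slot False l i}"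
          "{i \<in> {..<s}. ZY l (m + i)} = {i \<in> {..<s}. (i + s - l) mod s \<in> B}"
          unfolding ZY_def by auto
        then show ?thesis
          unfolding ks card_split_add using card_cyclic_difference(1)[OF AB(2) l] AB(4) by simp
      qed
      ultimately show ?thesis
        using slot_rows[OF l] ZZ(3)[OF l] g_eq by simp
    qed
  qed
qed

section \<open>Circulant constructions for few and for many pairs\<close>

lemma eq_if_close_and_mod_eq:
  fixes a b s :: nat
  assumes "a < b + s" "b < a + s" "a mod s = b mod s"
  shows "a = b"
proof -
  have "s dvd b - a" if "a \<le> b" using assms(3) mod_eq_dvd_iff_nat[OF that, of s] by simp
  moreover have "s dvd a - b" if "b \<le> a" using assms(3) mod_eq_dvd_iff_nat[OF that, of s] by simp
  ultimately show ?thesis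
    using assms(1,2) by (cases "a \<le> b") (auto dest!: dvd_imp_le)
qed

text \<open>An edge that wraps around has difference \<open>i + k - j < w\<close>, so it runs from
  the last \<open>w - 1\<close> columns to the first \<open>w - 1\<close>. A threshold
  \<open>h\<close> between them gives the order required for forcing.\<close>

lemma circulant_order:
  fixes i j k w :: nat
  assumes "(i + k - j) mod k < w" "i < k" "j < k"
  shows "j \<le> i \<or> i + 1 < w \<and> k < j + w"
  using assms cyclic_difference_eq[of i k j] by (auto split: if_splits)

text \<open>The largest \<open>f\<close> with \<open>2 * k * f \<le> s * d\<close> is used: the
  \<open>2 * f * m\<close> slots then fit into the capacity \<open>s * (d - 2 * f)\<close> of the
  \<open>z\<close> vertices, while the circulant degree \<open>w = d - f\<close> stays small enough
  to separate the wrap-around edges.\<close>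

lemma defining_set_few_pairs:
  fixes k m s d :: nat
  assumes ks: "k = m + s" and m: "2 \<le> m" "m < d" and ds: "d \<le> s" "even (s * d)"
  obtains V :: "nat set" and adj S col where
    "regular_chromatic_graph (2 * k + s) (2 * k + s - 1 - d) k V adj"
    "defining_set V adj S col" "card S = k - 1"
proof -
  define f where "f = s * d div (2 * k)"
  define w where "w = d - f"
  have k: "k > 0" using ks m by simp
  have f_le: "2 * k * f \<le> s * d" unfolding f_def by simp
  have f_gt: "s * d < 2 * k * (f + 1)"
    unfolding f_def using dividend_less_times_div[of "2 * k" "s * d"] k by (simp add: algebra_simps)
  \<comment> \<open>For \<open>d \<ge> 4\<close> this follows from \<open>m < d \<le> s\<close>. For
    \<open>d = 3\<close> it would fail at \<open>s = 3\<close>, which parity excludes.\<close>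
  have "2 * k \<le> s * d"
  proof (cases "d \<ge> 4")
    case True
    then have "s * 4 \<le> s * d" by (rule mult_le_mono2)
    then show ?thesis using ks m ds(1) by linarith
  next
    case False
    then have "d = 3" using m by simp
    then have "s \<noteq> 3" using ds(2) by auto
    then show ?thesis using ks m ds(1) \<open>d = 3\<close> by simp
  qed
  then have "f \<ge> 1" unfolding f_def using k by (simp add: Suc_le_eq div_greater_zero_iff)
  have "2 * f < d"
  proof -
    have "k * (2 * f) \<le> s * d" using f_le by (simp add: ac_simps)
    also have "\<dots> < k * d" using ks m by simp
    finally show ?thesis by simp
  qed
  then have w: "w \<ge> 1" "w \<le> d" "w + f = d" unfolding w_def by auto
  \<comment> \<open>Otherwise the maximality of \<open>f\<close> gives
    \<open>k * k < d * (2 * m + s) \<le> s * (2 * m + s)\<close>, but the last term is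
    \<open>k * k - m * m\<close>.\<close>
  have wk: "2 * w \<le> k + 1"
  proof (rule ccontr)
    assume "\<not> 2 * w \<le> k + 1"
    then have "k + (2 * f + 2) \<le> 2 * d" using w(3) by simp
    then have "k * (k + (2 * f + 2)) \<le> k * (2 * d)" by (rule mult_le_mono2)
    then have "k * k + s * d < 2 * k * d" using f_gt by (simp add: algebra_simps)
    moreover have "d * (2 * m + s) \<le> s * (2 * m + s)" using ds(1) by (rule mult_le_mono1)
    moreover have "s * d + d * (2 * m + s) = 2 * k * d" "k * k = s * (2 * m + s) + m * m"
      unfolding ks by (simp_all add: algebra_simps)
    ultimately show False by linarith
  qed
  have "w \<le> k" using w ds(1) ks by simp
  define PY where "PY j i \<longleftrightarrow> (i + k - j) mod k \<in> {..<w}" for j i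
  have rows: "card {i \<in> {..<k}. PY j i} = w" if "j < k" for j
    using card_cyclic_difference(1)[of "{..<w}" k j] that \<open>w \<le> k\<close> unfolding PY_def by simp
  have cols: "card {j \<in> {..<k}. PY j i} = w" if "i < k" for i
    using card_cyclic_difference(2)[of "{..<w}" k i] that \<open>w \<le> k\<close> unfolding PY_def by simp
  have order: "j \<le> i \<or> i + 1 < w \<and> k < j + w" if "PY j i" "j < k" "i < k" for j i
    using circulant_order[of i k j w] that unfolding PY_def by simp
  \<comment> \<open>Every column below \<open>m\<close> owns a block of \<open>2 * f\<close>
    consecutive slots, the first \<open>f\<close> for \<open>p\<close> and the others for
    \<open>y\<close>. As \<open>2 * f < d \<le> s\<close>, a block meets each \<open>z\<close> at
    most once.\<close>
  define N q side where "N = m * (2 * f)" and "q t = t div (2 * f)" and "side t \<longleftrightarrow> t mod (2 * f) < f" for t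
  have q_eq: "q t = i \<longleftrightarrow> i * (2 * f) \<le> t \<and> t < i * (2 * f) + 2 * f" for t i
  proof
    assume "q t = i"
    then have "t = i * (2 * f) + t mod (2 * f)" unfolding q_def by (metis div_mult_mod_eq)
    moreover have "t mod (2 * f) < 2 * f" using \<open>f \<ge> 1\<close> by simp
    ultimately show "i * (2 * f) \<le> t \<and> t < i * (2 * f) + 2 * f" by linarith
  next
    assume "i * (2 * f) \<le> t \<and> t < i * (2 * f) + 2 * f"
    then show "q t = i" unfolding q_def by (intro div_nat_eqI) (auto simp: ac_simps)
  qed
  have side_eq: "side t \<longleftrightarrow> t < i * (2 * f) + f" if "q t = i" for t i
  proof -
    have "t = i * (2 * f) + t mod (2 * f)" using that unfolding q_def by (metis div_mult_mod_eq)
    then show ?thesis unfolding side_def by linarith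
  qed
  have slot_in: "i * (2 * f) + 2 * f \<le> N" if "i < m" for i
  proof -
    have "Suc i * (2 * f) \<le> m * (2 * f)" using that by (intro mult_le_mono1) simp
    then show ?thesis unfolding N_def by simp
  qed
  \<comment> \<open>Wrap-around edges have \<open>y\<close> index below \<open>w - 1\<close> and, by
    \<open>wk\<close>, \<open>p\<close> index at least \<open>w\<close>. Hence
    \<open>h = w - 1\<close> separates them, and the \<open>p\<close> vertex of column
    \<open>w - 1\<close> can be left uncoloured.\<close>
  show thesis
  proof (rule defining_set_from_slots[where PY = PY and q = q and side = side and f = f and N = N
        and h = "w - 1" and c = "w - 1", OF ks _ _ _ _ _ \<open>f \<ge> 1\<close> _ ds _ _ _ _ _ _ _ _ that])
    show "w - 1 < k" using w \<open>w \<le> k\<close> by simp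
    show "PY i i" for i using w unfolding PY_def by simp
    show "j \<le> i \<or> i < w - 1 \<and> w - 1 \<le> j" if "PY j i" "j < k" "i < k" for j i
      using order[OF that] wk by linarith
    show "w - 1 \<le> i" if "PY (w - 1) i" "i < k" for i
      using order[OF that(1) _ that(2)] wk w \<open>w \<le> k\<close> by linarith
    show "N \<le> s * (d - 2 * f)"
      using f_le unfolding N_def ks by (simp add: algebra_simps)
    show "even N" unfolding N_def by simp
    show "q t < m" if "t < N" for t
      using that \<open>f \<ge> 1\<close> unfolding N_def q_def by (simp add: less_mult_imp_div_less)
    show "t = t'" if "q t = q t'" "t mod s = t' mod s" for t t'
    proof -
      have bounds: "q t * (2 * f) \<le> t" "t < q t * (2 * f) + s" "q t * (2 * f) \<le> t'" "t' < q t * (2 * f) + s"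
        using q_eq[of t "q t"] q_eq[of t' "q t"] that(1) \<open>2 * f < d\<close> ds(1) by auto
      show ?thesis
        by (rule eq_if_close_and_mod_eq[OF _ _ that(2)]) (use bounds in linarith)+
    qed
    show "card {j \<in> {..<k}. PY i j} + card {t \<in> {..<N}. q t = i \<and> side t} = d" if "i < m" for i
    proof -
      have slot: "q t = i \<and> side t \<longleftrightarrow> i * (2 * f) \<le> t \<and> t < i * (2 * f) + f" for t
        using q_eq[of t i] side_eq[of t i] trans_less_add1[of t "i * (2 * f) + f" f]
        by (metis add.assoc mult_2)
      have "{t \<in> {..<N}. q t = i \<and> side t} = {i * (2 * f)..<i * (2 * f) + f}"
        unfolding slot using slot_in[OF that] by auto
      then show ?thesis using rows[of i] that ks w(3) by simp
    qed
    show "card {j \<in> {..<k}. PY j i} + card {t \<in> {..<N}. q t = i \<and> \<not> side t} = d" if "i < m" for i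
    proof -
      have slot: "q t = i \<and> \<not> side t \<longleftrightarrow> i * (2 * f) + f \<le> t \<and> t < i * (2 * f) + 2 * f" for t
        using q_eq[of t i] side_eq[of t i] by (metis add_leD1 not_less)
      have "{t \<in> {..<N}. q t = i \<and> \<not> side t} = {i * (2 * f) + f..<i * (2 * f) + 2 * f}"
        unfolding slot using slot_in[OF that] by auto
      then show ?thesis using cols[of i] that ks w(3) by simp
    qed
  qed (use rows cols w \<open>2 * f < d\<close> in auto)
qed

text \<open>Now \<open>s * d\<close> may be less than \<open>2 * k\<close>, and with
  \<open>f = 1\<close> in all columns the slots would overload the \<open>z\<close> vertices. So
  most missing edges of the pairs are supplied inside the pairs, by \<open>X\<close>.\<close>

lemma defining_set_many_pairs:
  fixes k m s d :: nat
  assumes ks: "k = m + s" and m: "d \<le> m" and d: "2 \<le> d" and ds: "d \<le> s" "even (s * d)"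
  obtains V :: "nat set" and adj S col where
    "regular_chromatic_graph (2 * k + s) (2 * k + s - 1 - d) k V adj"
    "defining_set V adj S col" "card S = k - 1"
proof -
  define w where "w = d - 1"
  have w: "w \<ge> 1" "d = w + 1" using d unfolding w_def by auto
  have wm: "w < m" "w < s" using w m ds by auto
  have "w \<le> k" using w ds(1) ks by simp
  define C where "C j i \<longleftrightarrow> (i + k - j) mod k \<in> {..<w}" for j i
  \<comment> \<open>Edges of difference \<open>w\<close> raise the degrees where both columns are
    below \<open>m\<close>. The single edge from \<open>p\<close> in column \<open>m - 1\<close> to
    \<open>y\<close> in column \<open>w - 1\<close> cuts the slots from \<open>2 * w\<close> to
    \<open>2 * (w - 1)\<close>; for \<open>d = 2\<close> the capacity \<open>s * (d - 2)\<close> is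
    zero.\<close>
  define X where "X j i \<longleftrightarrow> j < m \<and> i < m \<and> i = j + w \<or> j = m - 1 \<and> i = w - 1" for j i
  define PY where "PY j i \<longleftrightarrow> C j i \<or> X j i" for j i
  have XC: "\<not> C j i" if "X j i" for i j
  proof -
    have "j < k" "i < k" using that wm ks unfolding X_def by auto
    then show ?thesis
      using that wm w cyclic_difference_eq[of i k j] ks unfolding X_def C_def by (auto split: if_splits)
  qed
  have rows: "card {i \<in> {..<k}. PY j i} = w + card {i \<in> {..<k}. X j i}" if "j < k" for j
  proof -
    have "{i \<in> {..<k}. PY j i} = {i \<in> {..<k}. C j i} \<union> {i \<in> {..<k}. X j i}"
      unfolding PY_def by auto
    moreover have "card ({i \<in> {..<k}. C j i} \<union> {i \<in> {..<k}. X j i}) =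
        card {i \<in> {..<k}. C j i} + card {i \<in> {..<k}. X j i}"
      by (rule card_Un_disjoint) (use XC in auto)
    moreover have "card {i \<in> {..<k}. C j i} = w"
      using card_cyclic_difference(1)[of "{..<w}" k j] that \<open>w \<le> k\<close> unfolding C_def by simp
    ultimately show ?thesis by simp
  qed
  have cols: "card {j \<in> {..<k}. PY j i} = w + card {j \<in> {..<k}. X j i}" if "i < k" for i
  proof -
    have "{j \<in> {..<k}. PY j i} = {j \<in> {..<k}. C j i} \<union> {j \<in> {..<k}. X j i}"
      unfolding PY_def by auto
    moreover have "card ({j \<in> {..<k}. C j i} \<union> {j \<in> {..<k}. X j i}) =
        card {j \<in> {..<k}. C j i} + card {j \<in> {..<k}. X j i}"
      by (rule card_Un_disjoint) (use XC in auto)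
    moreover have "card {j \<in> {..<k}. C j i} = w"
      using card_cyclic_difference(2)[of "{..<w}" k i] that \<open>w \<le> k\<close> unfolding C_def by simp
    ultimately show ?thesis by simp
  qed
  have order: "j \<le> i \<or> i + 1 < w \<and> k < j + w \<or> i = w - 1 \<and> j = m - 1"
    if "PY j i" "j < k" "i < k" for j i
    using circulant_order[of i k j w] that unfolding PY_def C_def X_def by auto
  \<comment> \<open>One slot for each vertex still short: \<open>y\<close> in the columns below
    \<open>w - 1\<close>, then \<open>p\<close> in the columns from \<open>m - w\<close> to
    \<open>m - 2\<close>.\<close>
  define N q side where "N = 2 * (w - 1)" and "q t = (if t < w - 1 then t else m + t + 1 - 2 * w)"
    and "side t \<longleftrightarrow> \<not> t < w - 1" for t
  \<comment> \<open>The extra edge ends at \<open>y\<close> index \<open>w - 1\<close>, whence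
    \<open>h = w\<close>. Column \<open>m\<close> lies after its \<open>p\<close> end and, as
    \<open>w < s\<close>, before the \<open>p\<close> ends of all wrap-around edges, so
    \<open>c = m\<close> is safe.\<close>
  show thesis
  proof (rule defining_set_from_slots[where PY = PY and q = q and side = side and f = 1 and N = N
        and h = w and c = m, OF ks _ _ _ _ _ _ _ ds _ _ _ _ _ _ _ _ that])
    show "w \<le> m" "m < k" using wm ks by auto
    show "PY i i" for i using w unfolding PY_def C_def by simp
    show "j \<le> i \<or> i < w \<and> w \<le> j" if "PY j i" "j < k" "i < k" for j i
      using order[OF that] wm w ks by linarith
    show "w \<le> i" if "PY m i" "i < k" for i
      using order[OF that(1) _ that(2)] wm ks by linarith
    have "(w - 1) * 2 \<le> (w - 1) * s" using ds(1) d by (intro mult_le_mono2) simp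
    then show "N \<le> s * (d - 2 * 1)"
      using w unfolding N_def by (simp add: ac_simps)
    show "even N" unfolding N_def by simp
    show "q t < m" if "t < N" for t
      using that wm unfolding N_def q_def by auto
    \<comment> \<open>Distinct slots of one column are a \<open>y\<close> slot \<open>t\<close> and
      the \<open>p\<close> slot \<open>t + 2 * w - 1 - m\<close>, fewer than \<open>s\<close>
      apart.\<close>
    show "t = t'" if "t < N" "t' < N" "q t = q t'" "t mod s = t' mod s" for t t'
    proof -
      have "t < t' + s" "t' < t + s"
        using that(1-3) wm unfolding N_def q_def by (auto split: if_splits)
      then show ?thesis using that(4) by (rule eq_if_close_and_mod_eq)
    qed
    show "card {j \<in> {..<k}. PY i j} + card {t \<in> {..<N}. q t = i \<and> side t} = d" if i: "i < m" for i
    proof (cases "i + w < m \<or> i = m - 1")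
      case True
      have "{t \<in> {..<N}. q t = i \<and> side t} = {}"
        using True i wm w unfolding N_def q_def side_def by (auto split: if_splits)
      moreover have "{j \<in> {..<k}. X i j} = {if i + w < m then i + w else w - 1}"
        using True wm w i ks unfolding X_def by auto
      ultimately show ?thesis using rows[of i] i ks w by simp
    next
      case False
      have "{t \<in> {..<N}. q t = i \<and> side t} = {i + 2 * w - 1 - m}"
        using False i wm w unfolding N_def q_def side_def by (auto split: if_splits)
      moreover have "{j \<in> {..<k}. X i j} = {}"
        using False unfolding X_def by auto
      ultimately show ?thesis using rows[of i] i ks w by simp
    qed
    show "card {j \<in> {..<k}. PY j i} + card {t \<in> {..<N}. q t = i \<and> \<not> side t} = d" if i: "i < m" for i
    proof (cases "i < w - 1")
      case True
      have "{t \<in> {..<N}. q t = i \<and> \<not> side t} = {i}"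
        using True unfolding N_def q_def side_def by (auto split: if_splits)
      moreover have "{j \<in> {..<k}. X j i} = {}"
        using True unfolding X_def by auto
      ultimately show ?thesis using cols[of i] i ks w by simp
    next
      case False
      have "{t \<in> {..<N}. q t = i \<and> \<not> side t} = {}"
        using False unfolding N_def q_def side_def by (auto split: if_splits)
      moreover have "{j \<in> {..<k}. X j i} = {if i < w then m - 1 else i - w}"
        using False i w wm ks unfolding X_def by auto
      ultimately show ?thesis using cols[of i] i ks w by simp
    qed
    show "card {j \<in> {..<k}. PY i j} + 1 = d" "card {j \<in> {..<k}. PY j i} + 1 = d" if "m \<le> i" "i < k" for i
    proof -
      have "{j \<in> {..<k}. X i j} = {}" "{j \<in> {..<k}. X j i} = {}"
        using that wm unfolding X_def by auto
      then show "card {j \<in> {..<k}. PY i j} + 1 = d" "card {j \<in> {..<k}. PY j i} + 1 = d"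
        using rows[OF that(2)] cols[OF that(2)] w by simp_all
    qed
  qed (use d in auto)
qed

section \<open>Parameters of the complement and choice of the construction\<close>

theorem theorem3p4:
  fixes k n r :: nat
  assumes "k \<ge> 4"
    and "2 * k \<le> n" and "n \<le> 3 * k - 2"
    and "r > 2 * (k - 1)"
    and "\<exists>(V :: nat set) adj. regular_chromatic_graph n r k V adj"
  shows "min_defining_number n r k = k - 1"
proof -
  define s m d where "s = n - 2 * k" and "m = k - s" and "d = n - 1 - r"
  have ks: "k = m + s" "2 \<le> m" and n: "n = 2 * k + s"
    using assms(1-3) unfolding s_def m_def by auto
  obtain V0 :: "nat set" and adj0 where G0: "regular_chromatic_graph n r k V0 adj0"
    using assms(5) by blast
  have "n > 0" using assms(1,2) by simp
  note bounds = regular_chromatic_graph_bounds[OF G0 this]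
  have nr: "n = d + r + 1" using bounds(2) unfolding d_def by simp
  then have "n \<le> k * (d + 1)" using bounds(3) by simp
  have "d \<le> s" using nr n assms(1,4) by simp
  \<comment> \<open>For \<open>d \<le> 1\<close> the class bound forces \<open>n = 2 * k\<close>, so
    \<open>s = d = 0\<close>, and then it reads \<open>n \<le> k\<close>.\<close>
  have "2 \<le> d"
  proof (rule ccontr)
    assume "\<not> 2 \<le> d"
    then have "k * (d + 1) \<le> k * 2" by (intro mult_le_mono2) simp
    then have "n = 2 * k" using \<open>n \<le> k * (d + 1)\<close> assms(2) by linarith
    then have "d = 0" using \<open>d \<le> s\<close> n by simp
    then show False using \<open>n \<le> k * (d + 1)\<close> \<open>n = 2 * k\<close> assms(1) by simp
  qed
  \<comment> \<open>If \<open>s\<close> is odd, so is \<open>n\<close>; then \<open>r\<close> is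
    even and \<open>d = n - 1 - r\<close> is even.\<close>
  have "even (s * d)"
  proof -
    have "even ((d + r + 1) * r)" using bounds(1) nr by simp
    moreover have "even s \<longleftrightarrow> even (d + r + 1)" using n nr by presburger
    ultimately show ?thesis by auto
  qed
  have r: "r = 2 * k + s - 1 - d" using n nr by simp
  obtain V :: "nat set" and adj S col where G: "regular_chromatic_graph n r k V adj"
    and D: "defining_set V adj S col" "card S = k - 1"
  proof (cases "m < d")
    case True
    then show thesis
      using defining_set_few_pairs[OF ks True \<open>d \<le> s\<close> \<open>even (s * d)\<close>] that unfolding r n by blast
  next
    case False
    then have "d \<le> m" by simp
    then show thesis
      using defining_set_many_pairs[OF ks(1) _ \<open>2 \<le> d\<close> \<open>d \<le> s\<close> \<open>even (s * d)\<close>] that unfolding r n by blast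
  qed
  have lower: "k - 1 \<le> defining_number W E" if "regular_chromatic_graph n r k W E" for W :: "nat set" and E
  proof -
    have "simple_graph W E" "chromatic_number W E = k"
      using that unfolding regular_chromatic_graph_def by auto
    then show ?thesis
      using defining_number_attained[of W E] card_defining_set_ge[of W E] by metis
  qed
  have "defining_number V adj \<le> k - 1"
    unfolding defining_number_def using D by (intro Least_le) blast
  then have "defining_number V adj = k - 1" using lower[OF G] by simp
  then show ?thesis
    unfolding min_defining_number_def using G lower by (intro Least_equality) blast+
qed

end
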